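(* Let $G$ be a graph and $p\geq 2$ an integer. If $G$ is the competition-common enemy graph of an acyclic digraph $D$ satisfying Conditions $C(p)$ and $C'(p)$, then $G$ is (isomorphic to) one of the following: (a) $I_q$ for some $q\geq 1$; (b) $K_r\cup I_q$ with $r\geq p$ and $q\geq 2$; (c) $H\cup I_q$ where $H$ is a graph with $|V(H)|<p$ having no isolated vertices, and $q\geq dk(H)$.
   Context: All graphs and digraphs are finite; $K_r$ is the complete graph on $r$ vertices, $I_q$ the edgeless graph on $q$ vertices, and $\cup$ denotes disjoint union. For a digraph $D$ and vertex $x$, $N^+_D(x)=\{v \mid (x,v)\in A(D)\}$ and $N^-_D(x)=\{v \mid (v,x)\in A(D)\}$. The competition-common enemy graph of $D$ is the simple undirected graph on $V(D)$ in which distinct $x,y$ are adjacent iff $N^+_D(x)\cap N^+_D(y)\neq\emptyset$ and $N^-_D(x)\cap N^-_D(y)\neq\emptyset$. For a vertex set $S$, $\mathcal{F}^+_D(S):=\{x\in S \mid N^+_D(x)\subseteq N^+_D(y)\ \forall y\in S\}$ and $\mathcal{F}^-_D(S):=\{x\in S \mid N^-_D(x)\subseteq N^-_D(y)\ \forall y\in S\}$. For an integer $p\geq2$, $D$ satisfies Condition $C(p)$ (resp. $C'(p)$) if $\mathcal{F}^+_D(S)\neq\emptyset$ (resp. $\mathcal{F}^-_D(S)\neq\emptyset$) for every set $S$ of exactly $p$ vertices of $D$. The double competition number $dk(H)$ of a graph $H$ is the minimum nonnegative integer $k$ such that $H$ together with $k$ new isolated vertices is the competition-common enemy graph of an acyclic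 digraph. *)

theory Defs
  imports "Graph_Theory.Graph_Theory"
begin

text \<open>
  Simple undirected graphs are represented, as usual in \<open>Graph_Theory\<close>, by finite loop-free
  symmetric digraphs: \<open>pair_graph G\<close>. Finite digraphs without parallel arcs are
  \<open>pair_fin_digraph D\<close>; loops are not excluded here, but are ruled out by \<open>acyclic (parcs D)\<close>.
\<close>

definition out_nbrs :: "'a pair_pre_digraph \<Rightarrow> 'a \<Rightarrow> 'a set" where
  "out_nbrs D x = {v. (x, v) \<in> parcs D}"

definition in_nbrs :: "'a pair_pre_digraph \<Rightarrow> 'a \<Rightarrow> 'a set" where
  "in_nbrs D x = {v. (v, x) \<in> parcs D}"

text \<open>The competition-common enemy graph.\<close>

definition cce_graph :: "'a pair_pre_digraph \<Rightarrow> 'a pair_pre_digraph" where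
  "cce_graph D =
     \<lparr> pverts = pverts D,
       parcs = {(x, y). x \<in> pverts D \<and> y \<in> pverts D \<and> x \<noteq> y \<and>
                  out_nbrs D x \<inter> out_nbrs D y \<noteq> {} \<and>
                  in_nbrs D x \<inter> in_nbrs D y \<noteq> {}} \<rparr>"

definition F_out :: "'a pair_pre_digraph \<Rightarrow> 'a set \<Rightarrow> 'a set" where
  "F_out D S = {x \<in> S. \<forall>y\<in>S. out_nbrs D x \<subseteq> out_nbrs D y}"

definition F_in :: "'a pair_pre_digraph \<Rightarrow> 'a set \<Rightarrow> 'a set" where
  "F_in D S = {x \<in> S. \<forall>y\<in>S. in_nbrs D x \<subseteq> in_nbrs D y}"

text \<open>Conditions \<open>C(p)\<close> and \<open>C'(p)\<close>; they are only meaningful for \<open>p \<ge> 2\<close>.\<close>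

definition condition_C :: "nat \<Rightarrow> 'a pair_pre_digraph \<Rightarrow> bool" where
  "condition_C p D \<longleftrightarrow> (\<forall>S \<subseteq> pverts D. card S = p \<longrightarrow> F_out D S \<noteq> {})"

definition condition_C' :: "nat \<Rightarrow> 'a pair_pre_digraph \<Rightarrow> bool" where
  "condition_C' p D \<longleftrightarrow> (\<forall>S \<subseteq> pverts D. card S = p \<longrightarrow> F_in D S \<noteq> {})"

definition complete_graph :: "nat \<Rightarrow> nat pair_pre_digraph" where
  "complete_graph r = \<lparr> pverts = {..<r}, parcs = {(u, v). u < r \<and> v < r \<and> u \<noteq> v} \<rparr>"

definition edgeless_graph :: "nat \<Rightarrow> nat pair_pre_digraph" where
  "edgeless_graph q = \<lparr> pverts = {..<q}, parcs = {} \<rparr>"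

definition disjoint_union ::
  "'a pair_pre_digraph \<Rightarrow> 'b pair_pre_digraph \<Rightarrow> ('a + 'b) pair_pre_digraph" (infixl \<open>\<uplus>\<^sub>G\<close> 65) where
  "G \<uplus>\<^sub>G H =
     \<lparr> pverts = pverts G <+> pverts H,
       parcs = map_prod Inl Inl ` parcs G \<union> map_prod Inr Inr ` parcs H \<rparr>"

definition isolated :: "'a pair_pre_digraph \<Rightarrow> 'a \<Rightarrow> bool" where
  "isolated G x \<longleftrightarrow> x \<in> pverts G \<and> (\<forall>y. (x, y) \<notin> parcs G \<and> (y, x) \<notin> parcs G)"

text \<open>
  The double competition number. A digraph whose competition-common enemy graph is \<open>H\<close> together
  with \<open>k\<close> new isolated vertices has the vertex set of the latter graph, so equality
  (instead of isomorphism) loses nothing. The minimum always exists: see \<open>dk_exists\<close>.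
\<close>

definition dk :: "'a pair_pre_digraph \<Rightarrow> nat" where
  "dk H = (LEAST k. \<exists>D. pair_fin_digraph D \<and> acyclic (parcs D) \<and>
                        cce_graph D = H \<uplus>\<^sub>G edgeless_graph k)"

lemma pair_graph_cce_graph:
  assumes "pair_fin_digraph D"
  shows "pair_graph (cce_graph D)"
proof -
  interpret pair_fin_digraph D by fact
  have "finite (parcs (cce_graph D))"
    by (rule finite_subset[of _ "pverts D \<times> pverts D"]) (auto simp: cce_graph_def pair_finite_verts)
  then show ?thesis
    by unfold_locales
      (auto simp: cce_graph_def pair_finite_verts symmetric_def sym_def Int_commute)
qed

lemma complete_digraph_complete_graph: "complete_digraph r (with_proj (complete_graph r))"
proof -
  have "finite {(u, v). u < r \<and> v < r \<and> u \<noteq> v}"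
    by (rule finite_subset[of _ "{..<r} \<times> {..<r}"]) auto
  then have "pair_graph (complete_graph r)"
    by unfold_locales (auto simp: complete_graph_def symmetric_def sym_def)
  then interpret pair_graph "complete_graph r" .
  show ?thesis
    unfolding complete_digraph_def
    using graph_axioms by (auto simp: complete_graph_def)
qed

text \<open>
  Each arc \<open>e i = (u, v)\<close> of \<open>H\<close> gets a new common in-neighbour \<open>Inr i\<close> and a new common
  out-neighbour \<open>Inr (m + i)\<close> of its two ends.
\<close>

lemma dk_exists:
  assumes "pair_graph H"
  shows "\<exists>k D. pair_fin_digraph D \<and> acyclic (parcs D) \<and> cce_graph D = H \<uplus>\<^sub>G edgeless_graph k"
proof -
  interpret pair_graph H by fact
  obtain m :: nat and e where e: "parcs H = e ` {i. i < m}"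
    using finite_imp_nat_seg_image_inj_on[OF pair_finite_arcs] by blast
  define end_of where "end_of i x \<longleftrightarrow> i < m \<and> (x = fst (e i) \<or> x = snd (e i))" for i x
  define A where "A = {(Inr i, Inl x) | i x. end_of i x} \<union> {(Inl x, Inr (m + i)) | i x. end_of i x}"
  define D where "D = \<lparr> pverts = pverts H <+> {..<2 * m}, parcs = A \<rparr>"
  have end_verts: "x \<in> pverts H" if "end_of i x" for i x
  proof -
    have "e i \<in> parcs H" using that e by (auto simp: end_of_def)
    with that show ?thesis
      using in_arcsD1[of "fst (e i)" "snd (e i)"] in_arcsD2[of "fst (e i)" "snd (e i)"]
      by (auto simp: end_of_def)
  qed
  have sub: "A \<subseteq> (pverts H <+> {..<2 * m}) \<times> (pverts H <+> {..<2 * m})"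
    using end_verts by (fastforce simp: A_def end_of_def)
  have "finite A"
    by (rule finite_subset[OF sub]) (simp add: pair_finite_verts)
  then have fin: "pair_fin_digraph D"
    using sub by unfold_locales (auto simp: D_def pair_finite_verts)
  define level :: "'a + nat \<Rightarrow> nat"
    where "level v = (case v of Inl _ \<Rightarrow> 1 | Inr i \<Rightarrow> if i < m then 0 else 2)" for v
  have "A \<subseteq> measure level"
    by (auto simp: A_def level_def end_of_def)
  then have acyc: "acyclic (parcs D)"
    by (auto simp: D_def intro: acyclic_subset wf_acyclic)
  have out_l: "out_nbrs D (Inl x) = {Inr (m + i) | i. end_of i x}"
    and in_l: "in_nbrs D (Inl x) = {Inr i | i. end_of i x}" for x
    by (auto simp: out_nbrs_def in_nbrs_def D_def A_def)
  have r: "out_nbrs D (Inr j) = {} \<or> in_nbrs D (Inr j) = {}" for j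
    by (auto simp: out_nbrs_def in_nbrs_def D_def A_def end_of_def)
  have share: "(\<exists>i. end_of i x \<and> end_of i y) \<longleftrightarrow> (x, y) \<in> parcs H" if neq: "x \<noteq> y" for x y
  proof
    assume "\<exists>i. end_of i x \<and> end_of i y"
    then obtain i where "i < m" and "e i = (x, y) \<or> e i = (y, x)"
      using neq by (auto simp: end_of_def prod_eq_iff)
    then have "(x, y) \<in> parcs H \<or> (y, x) \<in> parcs H" unfolding e by force
    then show "(x, y) \<in> parcs H"
      using pair_sym_arcs by (auto simp: symmetric_def sym_def)
  next
    assume "(x, y) \<in> parcs H"
    then obtain i where "i < m" "(x, y) = e i" by (auto simp: e)
    then show "\<exists>i. end_of i x \<and> end_of i y" by (auto simp: end_of_def intro!: exI[of _ i] dest: sym)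
  qed
  have noloop: "x \<noteq> y" if "(x, y) \<in> parcs H" for x y
    using pair_no_loops[OF that] by simp
  have arcs: "(v, w) \<in> parcs (cce_graph D) \<longleftrightarrow> (v, w) \<in> map_prod Inl Inl ` parcs H" for v w
  proof (cases "\<exists>x y. v = Inl x \<and> w = Inl y")
    case True
    then obtain x y where vw: "v = Inl x" "w = Inl y" by blast
    have "(v, w) \<in> parcs (cce_graph D) \<longleftrightarrow>
        x \<in> pverts H \<and> y \<in> pverts H \<and> x \<noteq> y \<and> (\<exists>i. end_of i x \<and> end_of i y)"
      unfolding vw cce_graph_def by (auto simp: out_l in_l) (auto simp: D_def)
    also have "\<dots> \<longleftrightarrow> (x, y) \<in> parcs H"
      using share noloop in_arcsD1 in_arcsD2 by metis
    also have "\<dots> \<longleftrightarrow> (v, w) \<in> map_prod Inl Inl ` parcs H"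
      by (auto simp: vw)
    finally show ?thesis .
  next
    case False
    then obtain j where "v = Inr j \<or> w = Inr j" by (metis sum.exhaust)
    then have "(v, w) \<notin> parcs (cce_graph D)"
      using r[of j] by (auto simp: cce_graph_def)
    with False show ?thesis by auto
  qed
  have "parcs (cce_graph D) = map_prod Inl Inl ` parcs H"
    using arcs by (intro set_eqI) (metis surj_pair)
  then have "cce_graph D = H \<uplus>\<^sub>G edgeless_graph (2 * m)"
    by (simp add: cce_graph_def disjoint_union_def edgeless_graph_def D_def)
  with fin acyc show ?thesis by blast
qed

end

theory Submission
  imports Defs
begin

text \<open>
  Taking a \<open>p\<close>-subset through two candidates shows that Conditions \<open>C(p)\<close> and \<open>C'(p)\<close> pass from
  \<open>p\<close>-sets to all larger sets. If at least \<open>p\<close> vertices of \<open>G\<close> are not isolated, a minimal one among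
  them has nonempty neighbourhoods, so all of them share an out-neighbour and an in-neighbour and
  form a clique; the ends of a maximal path of \<open>D\<close> are then two isolated vertices. If fewer than
  \<open>p\<close> are not isolated, \<open>H\<close> is the subgraph that they induce, and a relabelled copy of \<open>D\<close> itself
  bounds \<open>dk H\<close>. Graphs without edges fall into the latter case, with \<open>H\<close> empty.
\<close>

text \<open>Induction on the size of \<open>T\<close>: deleting a suitable \<open>m\<close> leaves a
  set with a least \<open>n\<close>. As \<open>p \<ge> 2\<close>, some \<open>p\<close>-subset of
  \<open>T\<close> holds both \<open>m\<close> and \<open>n\<close>; its least element lies below
  \<open>m\<close> and, through \<open>n\<close>, below everything else in \<open>T\<close>.\<close>

lemma least_set_of_card_ge:
  fixes N :: "'a \<Rightarrow> 'b set"
  assumes p: "p \<ge> 2"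
    and least: "\<And>T. T \<subseteq> S \<Longrightarrow> card T = p \<Longrightarrow> \<exists>x\<in>T. \<forall>y\<in>T. N x \<subseteq> N y"
    and S: "finite S" "card S \<ge> p"
  shows "\<exists>x\<in>S. \<forall>y\<in>S. N x \<subseteq> N y"
proof -
  \<comment> \<open>Ranging over all subsets of \<open>S\<close> lets the induction delete points;
    \<open>k\<close> is the excess of the size over \<open>p\<close>.\<close>
  have "\<exists>x\<in>T. \<forall>y\<in>T. N x \<subseteq> N y" if "T \<subseteq> S" "card T = p + k" for T k
    using that
  proof (induction k arbitrary: T)
    case 0
    then show ?case using least by simp
  next
    case (Suc k)
    have fin: "finite T" using Suc.prems(1) S(1) by (rule finite_subset)
    have step: "\<exists>m\<in>T - {a}. \<forall>y\<in>T - {a}. N m \<subseteq> N y" if "a \<in> T" for a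
      using Suc.IH[of "T - {a}"] Suc.prems fin that by auto
    obtain a where "a \<in> T" using Suc.prems(2) by fastforce
    then obtain m where m: "m \<in> T" and m_least: "\<forall>y\<in>T - {a}. N m \<subseteq> N y"
      using step by blast
    obtain n where n: "n \<in> T - {m}" and n_least: "\<forall>y\<in>T - {m}. N n \<subseteq> N y"
      using step[OF m] by blast
    have "p \<le> card T" using Suc.prems(2) by simp
    moreover have "card {m, n} \<le> p" using p n by (simp add: card_insert_if)
    ultimately obtain P where P: "{m, n} \<subseteq> P" "P \<subseteq> T" "card P = p"
      using exists_subset_between[of "{m, n}" p T] m n fin by auto
    then obtain z where "z \<in> P" "\<forall>y\<in>P. N z \<subseteq> N y"
      using least[of P] Suc.prems(1) by auto
    then show ?case using P n_least by blast
  qed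
  from this[of S "card S - p"] S(2) show ?thesis by simp
qed

lemma F_out_nonempty_of_card_ge:
  assumes "condition_C p D" "p \<ge> 2" "S \<subseteq> pverts D" "finite S" "card S \<ge> p"
  shows "F_out D S \<noteq> {}"
proof -
  have "\<exists>x\<in>S. \<forall>y\<in>S. out_nbrs D x \<subseteq> out_nbrs D y"
  proof (rule least_set_of_card_ge[of p])
    show "\<exists>x\<in>T. \<forall>y\<in>T. out_nbrs D x \<subseteq> out_nbrs D y" if "T \<subseteq> S" "card T = p" for T
    proof -
      have "F_out D T \<noteq> {}"
        using assms(1,3) that unfolding condition_C_def by blast
      then show ?thesis by (auto simp: F_out_def)
    qed
  qed (use assms in auto)
  then show ?thesis by (auto simp: F_out_def)
qed

lemma F_in_nonempty_of_card_ge: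
  assumes "condition_C' p D" "p \<ge> 2" "S \<subseteq> pverts D" "finite S" "card S \<ge> p"
  shows "F_in D S \<noteq> {}"
proof -
  have "\<exists>x\<in>S. \<forall>y\<in>S. in_nbrs D x \<subseteq> in_nbrs D y"
  proof (rule least_set_of_card_ge[of p])
    show "\<exists>x\<in>T. \<forall>y\<in>T. in_nbrs D x \<subseteq> in_nbrs D y" if "T \<subseteq> S" "card T = p" for T
    proof -
      have "F_in D T \<noteq> {}"
        using assms(1,3) that unfolding condition_C'_def by blast
      then show ?thesis by (auto simp: F_in_def)
    qed
  qed (use assms in auto)
  then show ?thesis by (auto simp: F_in_def)
qed

definition map_digraph :: "('a \<Rightarrow> 'b) \<Rightarrow> 'a pair_pre_digraph \<Rightarrow> 'b pair_pre_digraph" where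
  "map_digraph f D = \<lparr> pverts = f ` pverts D, parcs = map_prod f f ` parcs D \<rparr>"

context pair_wf_digraph
begin

lemma digraph_iso_map_digraph:
  assumes f: "inj_on f (pverts G)"
  shows "digraph_iso (with_proj G) (with_proj (map_digraph f G))"
proof -
  let ?h = "\<lparr> iso_verts = f, iso_arcs = map_prod f f, iso_head = snd, iso_tail = fst \<rparr>"
  have "inj_on (map_prod f f) (parcs G)"
    using map_prod_inj_on[OF f f] by (rule inj_on_subset) (auto dest: in_arcsD1 in_arcsD2)
  then have "pre_digraph.digraph_isomorphism (with_proj G) ?h"
    using f wf_digraph_axioms by (simp add: pre_digraph.digraph_isomorphism_def)
  moreover have "with_proj (map_digraph f G) = app_iso ?h (with_proj G)"
    by (simp add: app_iso_def with_proj_def map_digraph_def)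
  ultimately show ?thesis unfolding digraph_iso_def by blast
qed

text \<open>\<open>dk\<close> asks for equality with a disjoint union, not for isomorphism. Bounding
  it therefore takes a digraph on the new vertex names, and this makes a relabelled digraph usable
  there.\<close>

lemma cce_graph_map_digraph:
  assumes f: "inj_on f (pverts G)"
  shows "cce_graph (map_digraph f G) = map_digraph f (cce_graph G)"
proof -
  have out: "out_nbrs (map_digraph f G) (f x) = f ` out_nbrs G x" if "x \<in> pverts G" for x
    using that f by (force simp: out_nbrs_def map_digraph_def dest: inj_onD in_arcsD1)
  have inn: "in_nbrs (map_digraph f G) (f x) = f ` in_nbrs G x" if "x \<in> pverts G" for x
    using that f by (force simp: in_nbrs_def map_digraph_def dest: inj_onD in_arcsD2)
  \<comment> \<open>\<open>f\<close> is known to be injective only on \<open>pverts G\<close>, so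
    disjointness transfers for vertex sets; the two inclusions that follow make this apply to
    neighbourhoods.\<close>
  have disj: "f ` A \<inter> f ` B = {} \<longleftrightarrow> A \<inter> B = {}" if "A \<subseteq> pverts G" "B \<subseteq> pverts G" for A B
    using inj_on_image_Int[OF f that] by (metis image_is_empty)
  have out_verts: "out_nbrs G x \<subseteq> pverts G" for x
    by (auto simp: out_nbrs_def dest: in_arcsD2)
  have in_verts: "in_nbrs G x \<subseteq> pverts G" for x
    by (auto simp: in_nbrs_def dest: in_arcsD1)
  have arcs: "(f x, f y) \<in> parcs (cce_graph (map_digraph f G)) \<longleftrightarrow> (x, y) \<in> parcs (cce_graph G)"
    if "x \<in> pverts G" "y \<in> pverts G" for x y
    using that inj_on_eq_iff[OF f that]
    by (simp add: cce_graph_def out inn disj[OF out_verts out_verts] disj[OF in_verts in_verts])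
      (simp add: map_digraph_def)
  have "parcs (cce_graph (map_digraph f G)) = map_prod f f ` parcs (cce_graph G)"
  proof (intro set_eqI iffI)
    fix e assume e: "e \<in> parcs (cce_graph (map_digraph f G))"
    then obtain x y where "x \<in> pverts G" "y \<in> pverts G" "e = (f x, f y)"
      by (auto simp: cce_graph_def map_digraph_def)
    then show "e \<in> map_prod f f ` parcs (cce_graph G)"
      using e arcs by (auto intro: rev_image_eqI)
  next
    fix e assume "e \<in> map_prod f f ` parcs (cce_graph G)"
    then obtain x y where xy: "(x, y) \<in> parcs (cce_graph G)" "e = (f x, f y)"
      by auto
    then have "x \<in> pverts G" "y \<in> pverts G" by (auto simp: cce_graph_def)
    then show "e \<in> parcs (cce_graph (map_digraph f G))"
      using xy arcs by simp
  qed
  then show ?thesis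
    by (intro pair_pre_digraph.equality) (simp_all add: cce_graph_def map_digraph_def)
qed

end

context pair_fin_digraph
begin

lemma pair_fin_digraph_map_digraph: "pair_fin_digraph (map_digraph f G)"
  by unfold_locales
    (auto simp: map_digraph_def pair_finite_verts pair_finite_arcs dest: in_arcsD1 in_arcsD2)

text \<open>For finitely many arcs acyclicity amounts to well-foundedness, which passes to images
  under a map injective on the ends of arcs.\<close>

lemma acyclic_map_digraph:
  assumes "inj_on f (pverts G)" "acyclic (parcs G)"
  shows "acyclic (parcs (map_digraph f G))"
proof -
  have "wf (parcs G)"
    using pair_finite_arcs assms(2) by (rule finite_acyclic_wf)
  then have "wf (map_prod f f ` parcs G)"
    by (rule wf_map_prod_image_Dom_Ran)
      (use assms(1) in \<open>auto dest: inj_onD in_arcsD1 in_arcsD2\<close>)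
  then show ?thesis by (simp add: map_digraph_def wf_acyclic)
qed

text \<open>Take \<open>s\<close> minimal among the tails of arcs and \<open>t\<close> maximal among
  the heads. Choosing \<open>s\<close> among tails rather than all vertices forces
  \<open>s \<noteq> t\<close>: a vertex on no arc would be a source and a sink at once.\<close>

lemma ex_source_and_sink:
  assumes "acyclic (parcs G)" "(x, y) \<in> parcs G"
  obtains s t where "s \<in> pverts G" "t \<in> pverts G" "s \<noteq> t" "in_nbrs G s = {}" "out_nbrs G t = {}"
proof -
  have "wf (parcs G)" "wf ((parcs G)\<inverse>)"
    using assms(1) pair_finite_arcs by (auto intro: finite_acyclic_wf finite_acyclic_wf_converse)
  obtain s where s: "s \<in> {u. \<exists>v. (u, v) \<in> parcs G}"
    and s_min: "\<And>w. (w, s) \<in> parcs G \<Longrightarrow> w \<notin> {u. \<exists>v. (u, v) \<in> parcs G}"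
    using wfE_min[OF \<open>wf (parcs G)\<close>, of x "{u. \<exists>v. (u, v) \<in> parcs G}"] assms(2) by blast
  obtain t where t: "t \<in> {v. \<exists>u. (u, v) \<in> parcs G}"
    and t_max: "\<And>w. (w, t) \<in> (parcs G)\<inverse> \<Longrightarrow> w \<notin> {v. \<exists>u. (u, v) \<in> parcs G}"
    using wfE_min[OF \<open>wf ((parcs G)\<inverse>)\<close>, of y "{v. \<exists>u. (u, v) \<in> parcs G}"] assms(2) by blast
  show ?thesis
  proof
    show "s \<in> pverts G" using s by (blast dest: in_arcsD1)
    show "t \<in> pverts G" using t by (blast dest: in_arcsD2)
    show "in_nbrs G s = {}" using s_min unfolding in_nbrs_def by blast
    show out: "out_nbrs G t = {}" using t_max unfolding out_nbrs_def by blast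
    show "s \<noteq> t" using s out unfolding out_nbrs_def by blast
  qed
qed

text \<open>\<open>f\<close> follows \<open>h\<close> on \<open>M\<close> and numbers the remaining
  vertices. Leaving \<open>h\<close> open serves both cases of the theorem: the identity keeps the
  names of \<open>M\<close>, and a numbering of \<open>M\<close> matches
  \<open>complete_graph\<close>.\<close>

lemma split_off_isolated:
  fixes h :: "'a \<Rightarrow> 'b"
  assumes arcs: "parcs G \<subseteq> M \<times> M" and M: "M \<subseteq> pverts G" and h: "inj_on h M"
  obtains f where "inj_on f (pverts G)"
    and "map_digraph f G
      = \<lparr> pverts = h ` M, parcs = map_prod h h ` parcs G \<rparr> \<uplus>\<^sub>G edgeless_graph (card (pverts G - M))"
proof -
  obtain g where g: "bij_betw g (pverts G - M) {..<card (pverts G - M)}"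
    using ex_bij_betw_finite_nat[of "pverts G - M"] pair_finite_verts
    by (auto simp: atLeast0LessThan)
  define f :: "'a \<Rightarrow> 'b + nat" where "f v = (if v \<in> M then Inl (h v) else Inr (g v))" for v
  have "inj_on f (pverts G)"
    using h g by (auto simp: f_def inj_on_def bij_betw_def split: if_splits)
  moreover have "f ` pverts G = h ` M <+> {..<card (pverts G - M)}"
  proof -
    have "f ` pverts G = f ` M \<union> f ` (pverts G - M)" using M by blast
    also have "f ` M = Inl ` h ` M" by (auto simp: f_def)
    also have "f ` (pverts G - M) = Inr ` g ` (pverts G - M)" by (auto simp: f_def image_iff)
    finally show ?thesis using g by (simp add: bij_betw_def Plus_def)
  qed
  moreover have "map_prod f f ` parcs G = map_prod Inl Inl ` map_prod h h ` parcs G"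
    unfolding image_image by (rule image_cong) (use arcs in \<open>auto simp: f_def\<close>)
  ultimately show ?thesis
    by (intro that[of f]) (auto simp: map_digraph_def disjoint_union_def edgeless_graph_def)
qed

end

theorem theorem2p7:
  fixes G D :: "'a pair_pre_digraph" and p :: nat
  assumes "pair_graph G"
    and "p \<ge> 2"
    and "pair_fin_digraph D"
    and "acyclic (parcs D)"
    and "condition_C p D"
    and "condition_C' p D"
    and "G = cce_graph D"
  shows "(\<exists>q\<ge>1. digraph_iso (with_proj G) (with_proj (edgeless_graph q)))
    \<or> (\<exists>r q. r \<ge> p \<and> q \<ge> 2 \<and>
         digraph_iso (with_proj G) (with_proj (complete_graph r \<uplus>\<^sub>G edgeless_graph q)))
    \<or> (\<exists>(H :: 'a pair_pre_digraph) q.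
         pair_graph H \<and> card (pverts H) < p \<and> (\<forall>x. \<not> isolated H x) \<and> q \<ge> dk H \<and>
         digraph_iso (with_proj G) (with_proj (H \<uplus>\<^sub>G edgeless_graph q)))"
proof -
  interpret D: pair_fin_digraph D by fact
  interpret G: pair_graph G by fact
  have verts: "pverts G = pverts D" by (simp add: assms(7) cce_graph_def)
  have fin: "finite (pverts G)" by (rule G.pair_finite_verts)
  \<comment> \<open>As \<open>parcs G\<close> is symmetric, these are exactly the non-isolated
    vertices.\<close>
  define M where "M = Domain (parcs G)"
  have M: "M \<subseteq> pverts G" by (auto simp: M_def dest: G.in_arcsD1)
  have finM: "finite M" using M fin by (rule finite_subset)
  have arcs: "parcs G \<subseteq> M \<times> M"
    using G.pair_sym_arcs by (auto simp: M_def symmetric_def sym_def)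
  have nbrs: "out_nbrs D x \<noteq> {}" "in_nbrs D x \<noteq> {}" if "x \<in> M" for x
    using that by (auto simp: M_def assms(7) cce_graph_def)
  show ?thesis
  proof (cases "card M < p")
    case True
    define H where "H = \<lparr> pverts = M, parcs = parcs G \<rparr>"
    have H: "pair_graph H"
      using arcs G.pair_sym_arcs G.pair_no_loops
      by unfold_locales (auto simp: H_def finM G.pair_finite_arcs symmetric_def)
    have no_isolated: "\<not> isolated H x" for x
      by (auto simp: H_def isolated_def M_def)
    let ?q = "card (pverts G - M)"
    obtain f where f: "inj_on f (pverts G)" "map_digraph f G = H \<uplus>\<^sub>G edgeless_graph ?q"
      using G.split_off_isolated[OF arcs M inj_on_id] by (auto simp: H_def map_prod.id)
    \<comment> \<open>\<open>D\<close> has the same vertices as \<open>G\<close>, so the relabelling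
      found for \<open>G\<close> applies to \<open>D\<close> too and yields a digraph witnessing
      \<open>?q\<close> in the definition of \<open>dk\<close>.\<close>
    have "cce_graph (map_digraph f D) = H \<uplus>\<^sub>G edgeless_graph ?q"
      using D.cce_graph_map_digraph[of f] f verts assms(7) by simp
    moreover have "acyclic (parcs (map_digraph f D))"
      using D.acyclic_map_digraph[of f] f(1) verts assms(4) by simp
    ultimately have "dk H \<le> ?q"
      unfolding dk_def using D.pair_fin_digraph_map_digraph by (intro Least_le) blast
    moreover have "digraph_iso (with_proj G) (with_proj (H \<uplus>\<^sub>G edgeless_graph ?q))"
      using G.digraph_iso_map_digraph[OF f(1)] f(2) by simp
    moreover have "card (pverts H) < p" using True by (simp add: H_def)
    ultimately show ?thesis using H no_isolated by blast
  next
    case False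
    have MD: "M \<subseteq> pverts D" using M verts by simp
    obtain x where x: "x \<in> F_out D M"
      using F_out_nonempty_of_card_ge[OF assms(5,2) MD finM] False by fastforce
    obtain y where y: "y \<in> F_in D M"
      using F_in_nonempty_of_card_ge[OF assms(6,2) MD finM] False by fastforce
    have "x \<in> M" "y \<in> M" using x y by (auto simp: F_out_def F_in_def)
    \<comment> \<open>\<open>x\<close> and \<open>y\<close> may differ: \<open>u\<close> and
      \<open>w\<close> come from the least out- and in-neighbourhood separately, and each is shared
      by all of \<open>M\<close>.\<close>
    then obtain u w where "u \<in> out_nbrs D x" "w \<in> in_nbrs D y" using nbrs by blast
    then have uw: "u \<in> out_nbrs D z" "w \<in> in_nbrs D z" if "z \<in> M" for z
      using x y that by (auto simp: F_out_def F_in_def)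
    have clique: "parcs G = {(a, b). a \<in> M \<and> b \<in> M \<and> a \<noteq> b}"
    proof (intro subset_antisym)
      show "parcs G \<subseteq> {(a, b). a \<in> M \<and> b \<in> M \<and> a \<noteq> b}"
        using arcs G.pair_no_loops by fastforce
      show "{(a, b). a \<in> M \<and> b \<in> M \<and> a \<noteq> b} \<subseteq> parcs G"
        using uw MD by (fastforce simp: assms(7) cce_graph_def)
    qed
    obtain h where h: "bij_betw h M {..<card M}"
      using ex_bij_betw_finite_nat[OF finM] by (auto simp: atLeast0LessThan)
    have "map_prod h h ` {(a, b). a \<in> M \<and> b \<in> M \<and> a \<noteq> b}
      = {(a, b). a \<in> h ` M \<and> b \<in> h ` M \<and> a \<noteq> b}"
      using bij_betw_imp_inj_on[OF h] by (force simp: inj_on_def)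
    then have K: "\<lparr> pverts = h ` M, parcs = map_prod h h ` parcs G \<rparr> = complete_graph (card M)"
      unfolding clique using bij_betw_imp_surj_on[OF h] by (simp add: complete_graph_def)
    let ?q = "card (pverts G - M)"
    obtain f where f: "inj_on f (pverts G)"
      "map_digraph f G = complete_graph (card M) \<uplus>\<^sub>G edgeless_graph ?q"
      using G.split_off_isolated[OF arcs M bij_betw_imp_inj_on[OF h]] unfolding K by blast
    have iso: "digraph_iso (with_proj G) (with_proj (complete_graph (card M) \<uplus>\<^sub>G edgeless_graph ?q))"
      using G.digraph_iso_map_digraph[OF f(1)] f(2) by simp
    \<comment> \<open>Any arc of \<open>D\<close> will do here; it ensures that a source and a
      distinct sink exist.\<close>
    have "(x, u) \<in> parcs D" using uw \<open>x \<in> M\<close> by (simp add: out_nbrs_def)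
    then obtain s t where st: "s \<in> pverts D" "t \<in> pverts D" "s \<noteq> t"
      "in_nbrs D s = {}" "out_nbrs D t = {}"
      using D.ex_source_and_sink[OF assms(4)] by blast
    \<comment> \<open>Members of \<open>M\<close> have both in- and out-neighbours in
      \<open>D\<close>, which a source or a sink lacks.\<close>
    have "{s, t} \<subseteq> pverts G - M" using st nbrs verts by auto
    then have "card {s, t} \<le> ?q" using fin by (intro card_mono) auto
    then have "?q \<ge> 2" using st(3) by simp
    then show ?thesis using iso False by (meson not_less)
  qed
qed

end
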